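(* Let $n\ge1$, $s\in\{1,\dots,n\}$ and let $C\in\mathbb{R}^{n\times n}$ be symmetric positive definite. For every $t$ with $0<t\le\lambda_{\min}(C)$, $\hat z(0)\ge\hat z(t)$.
   Context: $\lambda_{\min}(C)$ is the smallest eigenvalue of $C$. For $0\le t\le\lambda_{\min}(C)$ let $A(t)\in\mathbb{R}^{n\times n}$ be a Cholesky factor of $C-tI$ (so $C-tI=A(t)^\top A(t)$), with $i$-th column $a_i(t)$, and for $x\in[0,1]^n$ let $M_t(x)=\sum_i x_i a_i(t)a_i(t)^\top$. For a positive semidefinite $X$ with eigenvalues $\lambda_1(X)\ge\dots\ge\lambda_n(X)$ and $t\ge0$, $\Phi_s(X;t)=\sum_{i=1}^s\log(\lambda_i(X)+t)$ (natural log); $\widehat{\Phi}_s(\cdot\,;t)$ is its concave envelope on the cone of $n\times n$ positive semidefinite matrices (pointwise infimum of all concave functions there that are $\ge\Phi_s(\cdot\,;t)$). $\hat z(t)=\max\{\widehat{\Phi}_s(M_t(x);t) : x\in[0,1]^n,\ \sum_i x_i=s\}$; in particular $\hat z(0)$ is the factorization bound. *)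

theory Defs
  imports "HOL-Analysis.Analysis" "HOL-Computational_Algebra.Polynomial"
    "HOL-Library.Extended_Real"
begin

definition psd_cone :: "(real^'n^'n) set" where
  "psd_cone = {X. transpose X = X \<and> (\<forall>v. 0 \<le> v \<bullet> (X *v v))}"

definition sym_pos_def :: "real^'n^'n \<Rightarrow> bool" where
  "sym_pos_def C \<longleftrightarrow> transpose C = C \<and> (\<forall>v. v \<noteq> 0 \<longrightarrow> 0 < v \<bullet> (C *v v))"

definition charpoly :: "real^'n^'n \<Rightarrow> real poly" where
  "charpoly A = det ((\<chi> i j. (if i = j then [:0, 1:] else 0) - [:A$i$j:]) :: real poly^'n^'n)"

(* eigenvalues with multiplicity, sorted decreasingly: lambda_1 >= ... >= lambda_n;
   entry k (0-based) is lambda_(k+1) *)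
definition eigs_desc :: "real^'n^'n \<Rightarrow> real list" where
  "eigs_desc X = rev (sorted_list_of_multiset (proots (charpoly X)))"

definition lambda_min :: "real^'n^'n \<Rightarrow> real" where
  "lambda_min C = Min {\<mu>. \<exists>v. v \<noteq> 0 \<and> C *v v = \<mu> *\<^sub>R v}"

definition elog :: "real \<Rightarrow> ereal" where
  "elog x = (if 0 < x then ereal (ln x) else -\<infinity>)"

definition Phi :: "nat \<Rightarrow> real \<Rightarrow> real^'n^'n \<Rightarrow> ereal" where
  "Phi s t X = (\<Sum>i<s. elog (eigs_desc X ! i + t))"

(* concavity of an extended-real-valued function on S (convex hypograph) *)
definition concave_ext :: "(real^'n^'n) set \<Rightarrow> (real^'n^'n \<Rightarrow> ereal) \<Rightarrow> bool" where
  "concave_ext S g \<longleftrightarrow> (\<forall>X\<in>S. \<forall>Y\<in>S. \<forall>\<theta>\<in>{0..1}. \<forall>a b::real.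
      ereal a \<le> g X \<longrightarrow> ereal b \<le> g Y \<longrightarrow>
      ereal (\<theta> * a + (1 - \<theta>) * b) \<le> g (\<theta> *\<^sub>R X + (1 - \<theta>) *\<^sub>R Y))"

definition Phi_hat :: "nat \<Rightarrow> real \<Rightarrow> real^'n^'n \<Rightarrow> ereal" where
  "Phi_hat s t X = Inf {g X | g. concave_ext psd_cone g \<and> (\<forall>Y\<in>psd_cone. Phi s t Y \<le> g Y)}"

definition cholesky_factor where
  "cholesky_factor A P \<longleftrightarrow> transpose A ** A = P \<and>
     (\<forall>(i::'a::{finite,wellorder}) j. j < i \<longrightarrow> (A$i$j::real) = 0) \<and> (\<forall>i. 0 \<le> A$i$i)"

definition outer :: "real^'n \<Rightarrow> real^'n^'n" where
  "outer v = (\<chi> j k. v$j * v$k)"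

definition M_of :: "real^'n^'n \<Rightarrow> real^'n \<Rightarrow> real^'n^'n" where
  "M_of A x = (\<Sum>i\<in>UNIV. x$i *\<^sub>R outer (column i A))"

(* zhat(t), computed from a Cholesky factor A of C - tI *)
definition zhat :: "nat \<Rightarrow> real \<Rightarrow> real^'n^'n \<Rightarrow> ereal" where
  "zhat s t A = Sup {Phi_hat s t (M_of A x) | x.
      (\<forall>i. 0 \<le> x$i \<and> x$i \<le> 1) \<and> (\<Sum>i\<in>UNIV. x$i) = real s}"

end

theory Submission
  imports Defs
begin

text \<open>Let \<open>D = diag(x)\<close>. The spectrum of \<open>M_t(x)\<close> is that of \<open>N = D^(1/2) (C - t I) D^(1/2)\<close>,
  and \<open>M_0(x)\<close> has the spectrum of \<open>N + t D\<close>. Write \<open>\<nu>\<close> for the eigenvalues of \<open>N\<close>. Since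
  \<open>0 \<le> D \<le> I\<close> and \<open>tr D = s\<close>, the eigenvalues of \<open>M_0(x)\<close> are majorized by \<open>\<nu> + t (1, \<dots>, 1, 0, \<dots>, 0)\<close>
  (\<open>s\<close> ones), hence by the vector \<open>(c, 0)\<close> that keeps its leading entries and spreads the remaining
  mass evenly over the other positions up to \<open>s\<close>. On one side, \<open>\<Sum> ln c_i\<close> is the value at \<open>M_t(x)\<close> of an affine
  majorant of \<open>Phi_s(.; t)\<close>. On the other side, by majorization \<open>M_0(x)\<close> is a convex
  combination of matrices with spectrum \<open>(c, 0)\<close>, at which \<open>Phi_s(.; 0)\<close> equals \<open>\<Sum> ln c_i\<close>, so every
  concave majorant of \<open>Phi_s(.; 0)\<close> is at least \<open>\<Sum> ln c_i\<close> at \<open>M_0(x)\<close>.\<close>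

section \<open>Characteristic polynomials of the two Gram matrices of a square matrix\<close>

lemma poly_det:
  fixes M :: "real poly^'n^'n"
  shows "poly (det M) x = det (\<chi> i j. poly (M$i$j) x)"
  by (simp add: det_def poly_sum poly_prod)

lemma poly_charpoly: "poly (charpoly A) x = det (mat x - A)"
  unfolding charpoly_def poly_det
  by (rule arg_cong[where f = det]) (simp add: vec_eq_iff mat_def)

lemma matrix_diff_ldistrib:
  fixes A :: "real^'n^'m"
  shows "A ** (B - C) = A ** B - A ** C"
  by (simp add: matrix_matrix_mult_def vec_eq_iff right_diff_distrib sum_subtractf)

lemma matrix_diff_rdistrib:
  fixes A :: "real^'n^'m"
  shows "(A - B) ** C = A ** C - B ** C"
  by (simp add: matrix_matrix_mult_def vec_eq_iff left_diff_distrib sum_subtractf)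

lemma mat_eq_scaleR: "(mat x :: real^'n^'n) = x *\<^sub>R mat 1"
  by (simp add: mat_def vec_eq_iff)

lemma invertible_if_ker:
  fixes A :: "real^'n^'n"
  assumes "\<And>v. A *v v = 0 \<Longrightarrow> v = 0"
  shows "invertible A"
  using assms by (simp add: invertible_left_inverse matrix_left_invertible_ker)

text \<open>The identity is immediate when \<open>B\<close> is invertible. Otherwise replace \<open>B\<close> by \<open>B + y I\<close>, which
  is invertible for large \<open>y\<close>; both sides are polynomials in \<open>y\<close>, so they also agree at \<open>y = 0\<close>.\<close>

lemma charpoly_gram_commute:
  fixes B :: "real^'n^'n"
  shows "charpoly (B ** transpose B) = charpoly (transpose B ** B)"
proof -
  have inv: "det (mat x - A ** transpose A) = det (mat x - transpose A ** A)"
    if "invertible A" for x and A :: "real^'n^'n"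
  proof -
    have e: "(mat x - A ** transpose A) ** A = A ** (mat x - transpose A ** A)"
      by (simp add: matrix_diff_ldistrib matrix_diff_rdistrib matrix_mul_assoc mat_eq_scaleR[of x]
          matrix_scalar_ac scalar_matrix_assoc[symmetric])
    have "det (mat x - A ** transpose A) * det A = det A * det (mat x - transpose A ** A)"
      using arg_cong[OF e, of det] by (simp add: det_mul)
    moreover have "det A \<noteq> 0" using that by (simp add: invertible_det_nz)
    ultimately show ?thesis by simp
  qed
  obtain K where K: "\<And>v. norm (B *v v) \<le> norm v * K"
    using bounded_linear.bounded[OF matrix_vector_mul_bounded_linear[of B]] by blast
  \<comment> \<open>Beyond the operator bound \<open>K\<close>, \<open>- y\<close> cannot be an
    eigenvalue of \<open>B\<close>, so the kernel of the shifted matrix is trivial.\<close>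
  have shift_inv: "invertible (B + mat y)" if "y > \<bar>K\<bar>" for y
  proof (rule invertible_if_ker)
    fix v assume "(B + mat y) *v v = 0"
    then have "B *v v = - (y *\<^sub>R v)"
      by (simp add: matrix_vector_mult_add_rdistrib mat_eq_scaleR[of y]
          scaleR_matrix_vector_assoc[symmetric] eq_neg_iff_add_eq_0)
    then have "y * norm v \<le> norm v * K" using K[of v] that by simp
    then have "norm v * (y - K) \<le> 0" by (simp add: algebra_simps)
    then have "norm v \<le> 0" using that by (auto simp: mult_le_0_iff)
    then show "v = 0" by simp
  qed
  have "poly (charpoly (B ** transpose B)) x = poly (charpoly (transpose B ** B)) x" for x
  proof -
    \<comment> \<open>Here \<open>x\<close> is fixed and \<open>y\<close> is the indeterminate:
      \<open>?b i j\<close> is the entry of \<open>B + y I\<close> as a linear polynomial in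
      \<open>y\<close>.\<close>
    let ?b = "\<lambda>i j. [:B$i$j, if i = j then 1 else 0:]"
    let ?m = "\<lambda>i j. [:mat x$i$j:] :: real poly"
    define p where "p = det ((\<chi> i j. ?m i j - (\<Sum>k\<in>UNIV. ?b i k * ?b j k)) :: real poly^'n^'n)"
    define q where "q = det ((\<chi> i j. ?m i j - (\<Sum>k\<in>UNIV. ?b k i * ?b k j)) :: real poly^'n^'n)"
    have p: "poly p y = det (mat x - (B + mat y) ** transpose (B + mat y))" for y
      unfolding p_def poly_det
      by (rule arg_cong[where f = det])
        (auto simp: vec_eq_iff poly_sum matrix_matrix_mult_def transpose_def mat_def algebra_simps
          intro!: sum.cong)
    have q: "poly q y = det (mat x - transpose (B + mat y) ** (B + mat y))" for y
      unfolding q_def poly_det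
      by (rule arg_cong[where f = det])
        (auto simp: vec_eq_iff poly_sum matrix_matrix_mult_def transpose_def mat_def algebra_simps
          intro!: sum.cong)
    have "{\<bar>K\<bar><..} \<subseteq> {y. poly (p - q) y = 0}"
      using inv[OF shift_inv] by (auto simp: p q)
    then have "infinite {y. poly (p - q) y = 0}"
      using infinite_Ioi finite_subset by blast
    then have "p - q = 0" using poly_roots_finite by blast
    then have "poly p 0 = poly q 0" by simp
    then show ?thesis by (simp add: p q poly_charpoly)
  qed
  then show ?thesis by (simp add: poly_eq_poly_eq_iff[symmetric] fun_eq_iff)
qed

section \<open>Orthonormal bases and matrices with a prescribed spectrum\<close>

definition orthonormal :: "(nat \<Rightarrow> real^'n) \<Rightarrow> bool" where
  "orthonormal q \<longleftrightarrow>
     (\<forall>i<CARD('n). \<forall>j<CARD('n). q i \<bullet> q j = (if i = j then 1 else 0))"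

text \<open>Vectors and eigenvalues are indexed by naturals below \<open>CARD('n)\<close>, to match
  positions in \<open>eigs_desc\<close> and to allow sums over the first \<open>m\<close> of
  them.\<close>

definition spec :: "(nat \<Rightarrow> real) \<Rightarrow> (nat \<Rightarrow> real^'n) \<Rightarrow> real^'n^'n" where
  "spec l q = (\<Sum>i<CARD('n). l i *\<^sub>R outer (q i))"

lemma outer_mult_vec: "outer u *v v = (u \<bullet> v) *\<^sub>R u"
  by (simp add: outer_def matrix_vector_mult_def vec_eq_iff inner_vec_def sum_distrib_left
      algebra_simps)

lemma outer_inner: "outer u \<bullet> X = u \<bullet> (X *v u)"
  by (simp add: outer_def inner_vec_def matrix_vector_mult_def sum_distrib_left algebra_simps)

lemma outer_inner_outer: "outer u \<bullet> outer v = (u \<bullet> v)\<^sup>2"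
  by (simp add: outer_inner outer_mult_vec power2_eq_square inner_commute)

lemma sum_matrix_vector_mult:
  "(\<Sum>i\<in>I. A i) *v v = (\<Sum>i\<in>I. (A i :: real^'n^'m) *v v)"
  by (induction I rule: infinite_finite_induct) (auto simp: matrix_vector_mult_add_rdistrib)

lemma spec_mult_vec:
  fixes q :: "nat \<Rightarrow> real^'n"
  shows "spec l q *v v = (\<Sum>i<CARD('n). (l i * (q i \<bullet> v)) *\<^sub>R q i)"
  by (simp add: spec_def sum_matrix_vector_mult scaleR_matrix_vector_assoc[symmetric] outer_mult_vec)

lemma index_ex: "\<exists>f::'n::finite \<Rightarrow> nat. bij_betw f UNIV {..<CARD('n)}"
  using ex_bij_betw_finite_nat[of "UNIV :: 'n set"] by (simp add: atLeast0LessThan)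

text \<open>The bijection \<open>f\<close> passes from natural indices to \<open>'n\<close>, where
  determinants are available. The rows of \<open>Q\<close> are the basis vectors, so orthonormality
  says that \<open>transpose Q\<close> is a right inverse, hence also a left inverse.\<close>

lemma orthonormal_matrix:
  fixes q :: "nat \<Rightarrow> real^'n"
  assumes q: "orthonormal q" and f: "bij_betw f (UNIV::'n set) {..<CARD('n)}"
  defines "Q \<equiv> (\<chi> a. q (f a)) :: real^'n^'n"
  shows "transpose Q ** Q = mat 1"
    and "spec l q = transpose Q ** (\<chi> a b. if a = b then l (f a) else 0) ** Q"
proof -
  have lt: "f a < CARD('n)" for a using f bij_betwE by fastforce
  have inj: "f a = f b \<longleftrightarrow> a = b" for a b using f by (auto simp: bij_betw_def inj_on_def)
  have "Q ** transpose Q = mat 1"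
    using q lt by (auto simp: Q_def vec_eq_iff matrix_matrix_mult_def transpose_def mat_def 
        orthonormal_def inner_vec_def inj)
  then show "transpose Q ** Q = mat 1" using matrix_left_right_inverse by blast
  have "spec l q = (\<Sum>a\<in>UNIV. l (f a) *\<^sub>R outer (q (f a)))"
    unfolding spec_def by (rule sum.reindex_bij_betw[OF f, symmetric])
  then show "spec l q = transpose Q ** (\<chi> a b. if a = b then l (f a) else 0) ** Q"
    by (simp add: Q_def vec_eq_iff matrix_matrix_mult_def transpose_def outer_def if_distrib 
        if_distribR cong: if_cong)
      (simp add: algebra_simps)
qed

lemma spec_one:
  fixes q :: "nat \<Rightarrow> real^'n"
  assumes "orthonormal q"
  shows "spec (\<lambda>_. 1) q = mat 1"
proof -
  obtain f :: "'n \<Rightarrow> nat" where f: "bij_betw f UNIV {..<CARD('n)}" using index_ex by blast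
  have "(\<chi> a b. if a = b then 1 else 0) = (mat 1 :: real^'n^'n)" by (simp add: mat_def)
  then show ?thesis
    using orthonormal_matrix(1)[OF assms f] by (simp add: orthonormal_matrix(2)[OF assms f])
qed

lemma parseval:
  fixes q :: "nat \<Rightarrow> real^'n"
  assumes "orthonormal q"
  shows "(\<Sum>i<CARD('n). (q i \<bullet> v)\<^sup>2) = v \<bullet> v"
proof -
  have "v \<bullet> v = v \<bullet> (spec (\<lambda>_. 1) q *v v)" by (simp add: spec_one[OF assms])
  also have "\<dots> = (\<Sum>i<CARD('n). (q i \<bullet> v)\<^sup>2)"
    by (simp add: spec_mult_vec inner_sum_right power2_eq_square inner_commute)
  finally show ?thesis by simp
qed

text \<open>Conjugation by an orthogonal matrix keeps the determinant and reduces the claim to a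
  diagonal matrix.\<close>

lemma charpoly_spec:
  fixes q :: "nat \<Rightarrow> real^'n"
  assumes "orthonormal q"
  shows "charpoly (spec l q) = (\<Prod>i<CARD('n). [:- l i, 1:])"
proof -
  obtain f :: "'n \<Rightarrow> nat" where f: "bij_betw f UNIV {..<CARD('n)}" using index_ex by blast
  define Q where "Q = (\<chi> a. q (f a))"
  note Q = orthonormal_matrix[OF assms f, folded Q_def]
  have "poly (charpoly (spec l q)) x = poly (\<Prod>i<CARD('n). [:- l i, 1:]) x" for x
  proof -
    let ?D = "(\<chi> a b. if a = b then x - l (f a) else 0) :: real^'n^'n"
    let ?L = "(\<chi> a b. if a = b then l (f a) else 0) :: real^'n^'n"
    have x: "mat x = transpose Q ** mat x ** Q"
      by (simp add: mat_eq_scaleR[of x] matrix_scalar_ac scalar_matrix_assoc[symmetric] Q(1))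
    have D: "?D = mat x - ?L" by (simp add: mat_def vec_eq_iff)
    have "mat x - spec l q = transpose Q ** ?D ** Q"
      by (subst x) (simp add: D Q(2) matrix_diff_ldistrib matrix_diff_rdistrib)
    moreover have "det (transpose Q) * det Q = 1"
      using arg_cong[OF Q(1), of det] by (simp add: det_mul)
    ultimately have "poly (charpoly (spec l q)) x = det ?D"
      by (simp add: poly_charpoly det_mul) 
    also have "\<dots> = (\<Prod>a\<in>UNIV. x - l (f a))"
      by (subst det_diagonal) auto
    also have "\<dots> = (\<Prod>i<CARD('n). x - l i)"
      by (rule prod.reindex_bij_betw[OF f])
    finally show ?thesis by (simp add: poly_prod)
  qed
  then show ?thesis by (simp add: poly_eq_poly_eq_iff[symmetric] fun_eq_iff)
qed

lemma sum_singleton_mset_upt: "(\<Sum>i<n. {#l i#}) = mset (map l [0..<n])"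
  by (induction n) auto

lemma eigs_desc_spec_mset:
  fixes q :: "nat \<Rightarrow> real^'n"
  assumes "orthonormal q"
  shows "eigs_desc (spec l q) = rev (sort (map l [0..<CARD('n)]))"
proof -
  have "proots (charpoly (spec l q)) = (\<Sum>i<CARD('n). {#l i#})"
    by (simp add: charpoly_spec[OF assms] proots_prod)
  also have "\<dots> = mset (map l [0..<CARD('n)])"
    by (rule sum_singleton_mset_upt)
  finally show ?thesis
    by (simp add: eigs_desc_def sorted_list_of_multiset_mset del: mset_map)
qed

lemma eigs_desc_spec:
  fixes q :: "nat \<Rightarrow> real^'n"
  assumes "orthonormal q" and "antimono_on {..<CARD('n)} l"
  shows "eigs_desc (spec l q) = map l [0..<CARD('n)]"
proof -
  have "sorted (rev (map l [0..<CARD('n)]))"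
    unfolding sorted_wrt_rev using assms(2)
    by (auto simp: sorted_wrt_iff_nth_less monotone_on_def)
  then have "sort (map l [0..<CARD('n)]) = rev (map l [0..<CARD('n)])"
    by (intro properties_for_sort) auto
  then show ?thesis by (simp add: eigs_desc_spec_mset[OF assms(1)])
qed


section \<open>The spectral theorem for symmetric matrices\<close>

lemma symmetric_inner:
  fixes X :: "real^'n^'n"
  assumes "transpose X = X"
  shows "(X *v u) \<bullet> v = u \<bullet> (X *v v)"
  by (metis assms dot_lmul_matrix transpose_matrix_vector)

text \<open>A maximizer \<open>v\<close> of the Rayleigh quotient on the unit sphere of
  \<open>S\<close> is an eigenvector: the residual \<open>r\<close> lies in \<open>S\<close> and is
  orthogonal to \<open>v\<close>, and if it were nonzero, a small step along it would increase the
  quotient to first order.\<close>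

lemma symmetric_eigenvector_in_subspace:
  fixes X :: "real^'n^'n"
  assumes X: "transpose X = X" and S: "subspace S" and inv: "\<And>v. v \<in> S \<Longrightarrow> X *v v \<in> S"
    and ne: "w \<in> S" "w \<noteq> 0"
  obtains v m where "v \<in> S" "norm v = 1" "X *v v = m *\<^sub>R v"
proof -
  let ?K = "S \<inter> sphere 0 1"
  have "compact ?K" using S by (simp add: closed_subspace closed_Int_compact)
  moreover have "w /\<^sub>R norm w \<in> ?K" using ne S by (simp add: subspace_scale)
  moreover have "continuous_on ?K (\<lambda>v. v \<bullet> (X *v v))"
    by (intro continuous_intros matrix_vector_mult_linear_continuous_on)
  ultimately obtain v where v: "v \<in> ?K" and max: "\<And>u. u \<in> ?K \<Longrightarrow> u \<bullet> (X *v u) \<le> v \<bullet> (X *v v)"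
    using continuous_attains_sup[of ?K "\<lambda>v. v \<bullet> (X *v v)"] by blast
  define m where "m = v \<bullet> (X *v v)"
  have vv: "v \<bullet> v = 1" and vS: "v \<in> S" using v by (auto simp: dot_square_norm)
  have gen: "u \<bullet> (X *v u) \<le> m * (u \<bullet> u)" if "u \<in> S" for u
  proof (cases "u = 0")
    case False
    have "u /\<^sub>R norm u \<in> ?K" using that False S by (simp add: subspace_scale)
    from max[OF this] have "(u \<bullet> (X *v u)) / (norm u)\<^sup>2 \<le> m"
      by (simp add: matrix_vector_mult_scaleR m_def power2_eq_square divide_simps)
    then show ?thesis using False by (simp add: divide_simps dot_square_norm)
  qed simp
  define r where "r = X *v v - m *\<^sub>R v"
  have rS: "r \<in> S" using vS inv S by (simp add: r_def subspace_diff subspace_scale)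
  have vr: "v \<bullet> r = 0" by (simp add: r_def inner_diff_right vv m_def)
  have rX: "r \<bullet> (X *v v) = r \<bullet> r"
    by (subst (3) r_def) (simp add: inner_diff_right inner_commute[of r v] vr)
  have "\<not> r \<bullet> r > 0"
  proof
    assume pos: "r \<bullet> r > 0"
    define k where "k = m * (r \<bullet> r) - r \<bullet> (X *v r)"
    \<comment> \<open>Maximality at \<open>v + e r\<close>: the left side is the first-order gain,
      the right side collects the second-order terms.\<close>
    have *: "2 * e * (r \<bullet> r) \<le> e\<^sup>2 * k" for e
    proof -
      have "v + e *\<^sub>R r \<in> S" using vS rS S by (simp add: subspace_add subspace_scale)
      from gen[OF this] show ?thesis
        using symmetric_inner[OF X, of v r] vr vv rX
        by (simp add: k_def inner_add_left inner_add_right matrix_vector_right_distrib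
            matrix_vector_mult_scaleR m_def[symmetric] inner_commute[of "X *v v" r] inner_commute[of r v]
            algebra_simps power2_eq_square)
    qed
    \<comment> \<open>Small enough that the second-order term cannot absorb the first-order gain;
      the \<open>+ 1\<close> avoids division by zero.\<close>
    define e where "e = (r \<bullet> r) / (\<bar>k\<bar> + 1)"
    have e: "e > 0" "e * k \<le> r \<bullet> r"
      using pos by (auto simp: e_def divide_simps intro!: mult_left_mono)
    have "2 * (r \<bullet> r) \<le> e * k" using *[of e] e(1) by (simp add: power2_eq_square)
    then show False using e(2) pos by linarith
  qed
  then have "r = 0" by simp
  then show thesis using that[of v m] v by (simp add: r_def)
qed

text \<open>The orthogonal complement of the first \<open>k\<close> eigenvectors is invariant under
  a symmetric matrix and nonzero while \<open>k\<close> is below the dimension, so it contains the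
  next eigenvector.\<close>

lemma symmetric_eigenvector_family:
  fixes X :: "real^'n^'n"
  assumes X: "transpose X = X"
  shows "k \<le> CARD('n) \<Longrightarrow> \<exists>q l. (\<forall>i<k. \<forall>j<k. q i \<bullet> q j = (if i = j then 1 else 0)) \<and>
    (\<forall>i<k. X *v q i = l i *\<^sub>R q i)"
proof (induction k)
  case (Suc k)
  then obtain q l where q: "\<And>i j. i < k \<Longrightarrow> j < k \<Longrightarrow> q i \<bullet> q j = (if i = j then 1 else 0)"
    and l: "\<And>i. i < k \<Longrightarrow> X *v q i = l i *\<^sub>R q i" by auto
  define S where "S = {v. \<forall>i<k. q i \<bullet> v = 0}"
  have S: "subspace S" by (simp add: subspace_def S_def inner_add_right)
  have inv: "X *v v \<in> S" if "v \<in> S" for v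
    using that by (auto simp: S_def symmetric_inner[OF X, symmetric] l)
  have "dim (q ` {..<k}) \<le> card (q ` {..<k})" by (simp add: dim_le_card')
  also have "\<dots> < DIM(real^'n)" using Suc.prems card_image_le[of "{..<k}" q] by simp
  finally obtain w where "w \<noteq> 0" "\<And>y. y \<in> span (q ` {..<k}) \<Longrightarrow> orthogonal w y"
    using orthogonal_to_subspace_exists by blast
  then have w: "w \<in> S" "w \<noteq> 0"
    by (auto simp: S_def orthogonal_def inner_commute[of w] span_base)
  obtain v m where v: "v \<in> S" "norm v = 1" "X *v v = m *\<^sub>R v"
    using symmetric_eigenvector_in_subspace[OF X S inv w] by blast
  have "v \<bullet> v = 1" using v by (simp add: dot_square_norm)
  then show ?case
    using q l v by (intro exI[of _ "q(k := v)"] exI[of _ "l(k := m)"])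
      (auto simp: less_Suc_eq S_def inner_commute)
qed auto

lemma sorting_permutation:
  fixes f :: "nat \<Rightarrow> real"
  obtains p where "p permutes {..<n}" "antimono_on {..<n} (f \<circ> p)"
proof -
  let ?xs = "rev (sort (map f [0..<n]))"
  have "mset ?xs = mset (map f [0..<n])" by simp
  then obtain p where p: "p permutes {..<length (map f [0..<n])}"
    "permute_list p (map f [0..<n]) = ?xs" by (rule mset_eq_permutation)
  have n: "p permutes {..<n}" using p(1) by simp
  have nth: "f (p i) = ?xs ! i" if "i < n" for i
    using that p(2)[symmetric] permutes_in_image[OF n, of i] by (simp add: permute_list_nth[OF p(1)])
  have "sorted_wrt (\<ge>) ?xs" by (simp add: sorted_wrt_rev)
  then have "antimono_on {..<n} (f \<circ> p)"
    by (auto simp: monotone_on_def nth sorted_wrt_iff_nth_less le_less)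
  then show thesis using that n by blast
qed

lemma orthonormal_permute:
  fixes q :: "nat \<Rightarrow> real^'n"
  assumes q: "orthonormal q" and p: "p permutes {..<CARD('n)}"
  shows "orthonormal (q \<circ> p)"
proof -
  have "p i < CARD('n)" if "i < CARD('n)" for i using permutes_in_image[OF p, of i] that by simp
  then show ?thesis
    using q by (simp add: orthonormal_def inj_eq[OF permutes_inj[OF p]])
qed

lemma spec_permute:
  fixes q :: "nat \<Rightarrow> real^'n"
  assumes p: "p permutes {..<CARD('n)}"
  shows "spec (l \<circ> p) (q \<circ> p) = spec l q"
  unfolding spec_def using sum.permute[OF p, of "\<lambda>i. l i *\<^sub>R outer (q i)"] by (simp add: o_def)

lemma spectral_decomposition:
  fixes X :: "real^'n^'n"
  assumes X: "transpose X = X"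
  obtains q where "orthonormal q" "X = spec (\<lambda>i. eigs_desc X ! i) q"
    "antimono_on {..<CARD('n)} (\<lambda>i. eigs_desc X ! i)"
proof -
  obtain q l where q: "orthonormal q" and l: "\<And>i. i < CARD('n) \<Longrightarrow> X *v q i = l i *\<^sub>R q i"
    using symmetric_eigenvector_family[OF X order_refl] unfolding orthonormal_def by blast
  \<comment> \<open>Apply \<open>X\<close> to the expansion of \<open>v\<close> in the
    eigenbasis.\<close>
  have "spec l q *v v = X *v v" for v
  proof -
    have "X *v v = X *v (spec (\<lambda>_. 1) q *v v)" by (simp add: spec_one[OF q])
    also have "\<dots> = (\<Sum>i<CARD('n). (l i * (q i \<bullet> v)) *\<^sub>R q i)"
      by (simp add: spec_mult_vec l linear_sum[OF matrix_vector_mul_linear] 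
          matrix_vector_mult_scaleR mult.commute)
    finally show ?thesis by (simp add: spec_mult_vec)
  qed
  then have Xl: "X = spec l q" by (simp add: matrix_eq)
  obtain p where p: "p permutes {..<CARD('n)}" "antimono_on {..<CARD('n)} (l \<circ> p)"
    using sorting_permutation by blast
  have q': "orthonormal (q \<circ> p)" using orthonormal_permute[OF q p(1)] .
  have X': "X = spec (l \<circ> p) (q \<circ> p)" by (simp add: spec_permute[OF p(1)] Xl)
  have eigs: "eigs_desc X ! i = (l \<circ> p) i" if "i < CARD('n)" for i
    using eigs_desc_spec[OF q' p(2)] that by (simp add: X'[symmetric])
  have "X = spec (\<lambda>i. eigs_desc X ! i) (q \<circ> p)"
    by (subst X') (simp add: spec_def eigs)
  moreover have "antimono_on {..<CARD('n)} (\<lambda>i. eigs_desc X ! i)"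
    using p(2) by (simp add: monotone_on_def eigs)
  ultimately show thesis using that q' by blast
qed


section \<open>Rearrangement and trace inequalities\<close>

text \<open>Summation by parts: the partial sums \<open>H\<close> of \<open>g - f\<close> are
  nonnegative and \<open>w\<close> decreases. Since \<open>H\<close> vanishes at \<open>n\<close>,
  the signs of \<open>w\<close> do not matter.\<close>

lemma abel_sum_mono:
  fixes w f g :: "nat \<Rightarrow> real"
  assumes w: "antimono_on {..<n} w"
    and le: "\<And>m. m \<le> n \<Longrightarrow> (\<Sum>i<m. f i) \<le> (\<Sum>i<m. g i)"
    and eq: "(\<Sum>i<n. f i) = (\<Sum>i<n. g i)"
  shows "(\<Sum>i<n. w i * f i) \<le> (\<Sum>i<n. w i * g i)"
proof -
  define H where "H m = (\<Sum>i<m. g i - f i)" for m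
  have H: "0 \<le> H m" if "m \<le> n" for m using le[OF that] by (simp add: H_def sum_subtractf)
  have bound: "Suc m \<le> n \<Longrightarrow> w m * H (Suc m) \<le> (\<Sum>i<Suc m. w i * (g i - f i))" for m
  proof (induction m)
    case (Suc m)
    have "w (Suc m) * H (Suc m) \<le> w m * H (Suc m)"
      using Suc.prems w H by (intro mult_right_mono) (auto simp: monotone_on_def)
    also have "\<dots> \<le> (\<Sum>i<Suc m. w i * (g i - f i))" using Suc by simp
    finally show ?case by (simp add: H_def distrib_left)
  qed (simp add: H_def)
  then have "0 \<le> (\<Sum>i<n. w i * (g i - f i))"
  proof (cases n)
    case (Suc m)
    then show ?thesis using bound[of m] eq by (simp add: H_def sum_subtractf)
  qed simp
  then show ?thesis by (simp add: right_diff_distrib sum_subtractf)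
qed

text \<open>Moving all the weight to the first \<open>m\<close> positions only increases partial
  sums of the weights and keeps their total.\<close>

lemma weighted_sum_le_top_sum:
  fixes w p :: "nat \<Rightarrow> real"
  assumes w: "antimono_on {..<n} w" and p: "\<And>i. i < n \<Longrightarrow> 0 \<le> p i \<and> p i \<le> 1"
    and m: "m \<le> n" "(\<Sum>i<n. p i) = real m"
  shows "(\<Sum>i<n. w i * p i) \<le> (\<Sum>i<m. w i)"
proof -
  let ?g = "\<lambda>i. if i < m then 1 else 0 :: real"
  have cut: "(\<Sum>i<k. h i * ?g i) = (\<Sum>i<min k m. h i)" for k and h :: "nat \<Rightarrow> real"
    by (simp add: if_distrib sum.If_cases lessThan_def Collect_conj_eq[symmetric] cong: if_cong)
  have "(\<Sum>i<n. w i * p i) \<le> (\<Sum>i<n. w i * ?g i)"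
  proof (rule abel_sum_mono[OF w])
    fix k assume k: "k \<le> n"
    have "(\<Sum>i<k. p i) \<le> (\<Sum>i<k. 1)" using p k by (intro sum_mono) auto
    moreover have "(\<Sum>i<k. p i) \<le> (\<Sum>i<n. p i)" using p k by (intro sum_mono2) auto
    ultimately show "(\<Sum>i<k. p i) \<le> (\<Sum>i<k. ?g i)"
      using cut[of "\<lambda>_. 1" k] m by (simp add: min_def)
  qed (use cut[of "\<lambda>_. 1" n] m in \<open>simp add: min_def\<close>)
  also have "\<dots> = (\<Sum>i<m. w i)" using cut[of w n] m by (simp add: min_def)
  finally show ?thesis .
qed

text \<open>By Parseval the squared overlaps of two bases form a doubly stochastic matrix. Its row
  sums over \<open>m\<close> columns are admissible weights for
  \<open>weighted_sum_le_top_sum\<close>.\<close>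

lemma orthonormal_overlap:
  fixes p q :: "nat \<Rightarrow> real^'n"
  assumes p: "orthonormal p" and q: "orthonormal q" and m: "m \<le> CARD('n)"
  shows "i < CARD('n) \<Longrightarrow> (\<Sum>j<m. (p i \<bullet> q j)\<^sup>2) \<le> 1"
    and "i < CARD('n) \<Longrightarrow> (\<Sum>j<CARD('n). (p i \<bullet> q j)\<^sup>2) = 1"
    and "(\<Sum>i<CARD('n). \<Sum>j<m. (p i \<bullet> q j)\<^sup>2) = real m"
proof -
  show *: "(\<Sum>j<CARD('n). (p i \<bullet> q j)\<^sup>2) = 1" if "i < CARD('n)" for i
    using parseval[OF q, of "p i"] that p by (simp add: orthonormal_def inner_commute)
  show "(\<Sum>j<m. (p i \<bullet> q j)\<^sup>2) \<le> 1" if "i < CARD('n)"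
    unfolding *[OF that, symmetric] using m by (intro sum_mono2) auto
  have "(\<Sum>i<CARD('n). (p i \<bullet> q j)\<^sup>2) = 1" if "j < m" for j
    using parseval[OF p, of "q j"] that m q by (simp add: orthonormal_def)
  then show "(\<Sum>i<CARD('n). \<Sum>j<m. (p i \<bullet> q j)\<^sup>2) = real m"
    by (subst sum.swap) simp
qed

lemma spec_inner_outer:
  fixes p :: "nat \<Rightarrow> real^'n"
  shows "spec a p \<bullet> outer v = (\<Sum>i<CARD('n). a i * (p i \<bullet> v)\<^sup>2)"
  by (simp add: spec_def inner_sum_left outer_inner_outer)

lemma spec_inner_outer_self:
  fixes p :: "nat \<Rightarrow> real^'n"
  assumes "orthonormal p" and "j < CARD('n)"
  shows "spec a p \<bullet> outer (p j) = a j"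
proof -
  have "spec a p \<bullet> outer (p j) = (\<Sum>i<CARD('n). if i = j then a i else 0)"
    unfolding spec_inner_outer using assms by (intro sum.cong) (auto simp: orthonormal_def)
  then show ?thesis using assms by simp
qed

text \<open>The diagonal \<open>f\<close> of \<open>spec a p\<close> in the basis \<open>q\<close>
  is majorized by its spectrum \<open>a\<close>; pairing with the decreasing \<open>b\<close>
  preserves this order.\<close>

lemma von_neumann_trace:
  fixes p q :: "nat \<Rightarrow> real^'n"
  assumes p: "orthonormal p" and q: "orthonormal q"
    and a: "antimono_on {..<CARD('n)} a" and b: "antimono_on {..<CARD('n)} b"
  shows "spec a p \<bullet> spec b q \<le> (\<Sum>i<CARD('n). a i * b i)"
proof -
  let ?n = "CARD('n)"
  define f where "f j = (\<Sum>i<?n. a i * (p i \<bullet> q j)\<^sup>2)" for j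
  have part: "(\<Sum>j<m. f j) = (\<Sum>i<?n. a i * (\<Sum>j<m. (p i \<bullet> q j)\<^sup>2))" for m
    unfolding f_def by (subst sum.swap) (simp add: sum_distrib_left)
  have "spec a p \<bullet> spec b q = (\<Sum>j<?n. b j * f j)"
    by (simp add: spec_def[of b] inner_sum_right spec_inner_outer f_def)
  also have "\<dots> \<le> (\<Sum>j<?n. b j * a j)"
  proof (rule abel_sum_mono[OF b])
    show "(\<Sum>j<m. f j) \<le> (\<Sum>j<m. a j)" if "m \<le> ?n" for m
      unfolding part using orthonormal_overlap[OF p q that] that
      by (intro weighted_sum_le_top_sum[OF a]) (auto intro: sum_nonneg)
    show "(\<Sum>j<?n. f j) = (\<Sum>j<?n. a j)"
      unfolding part using orthonormal_overlap(2)[OF p q order_refl] by simp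
  qed
  finally show ?thesis by (simp add: mult.commute)
qed

section \<open>Affine majorants and the water-filled vector\<close>

lemma concave_ext_affine:
  fixes T :: "real^'n^'n"
  shows "concave_ext S (\<lambda>Y. ereal (b + T \<bullet> Y))"
  unfolding concave_ext_def
proof (intro ballI allI impI)
  fix X Y :: "real^'n^'n" and \<theta> x y :: real
  assume \<theta>: "\<theta> \<in> {0..1}" and "ereal x \<le> ereal (b + T \<bullet> X)" "ereal y \<le> ereal (b + T \<bullet> Y)"
  then have "\<theta> * x + (1 - \<theta>) * y \<le> \<theta> * (b + T \<bullet> X) + (1 - \<theta>) * (b + T \<bullet> Y)"
    by (intro add_mono mult_left_mono) auto
  then show "ereal (\<theta> * x + (1 - \<theta>) * y) \<le> ereal (b + T \<bullet> (\<theta> *\<^sub>R X + (1 - \<theta>) *\<^sub>R Y))"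
    by (simp add: inner_add_right algebra_simps)
qed

lemma eigs_desc_nonneg:
  fixes X :: "real^'n^'n"
  assumes X: "X \<in> psd_cone" and i: "i < CARD('n)"
  shows "0 \<le> eigs_desc X ! i"
proof -
  obtain q where q: "orthonormal q" and Xq: "X = spec (\<lambda>i. eigs_desc X ! i) q"
    using X spectral_decomposition unfolding psd_cone_def by blast
  have "0 \<le> X \<bullet> outer (q i)"
    using X by (simp add: inner_commute[of X] outer_inner psd_cone_def)
  also have "X \<bullet> outer (q i) = eigs_desc X ! i"
    by (subst Xq) (rule spec_inner_outer_self[OF q i])
  finally show ?thesis .
qed

text \<open>The majorant is the tangent of \<open>ln\<close> at \<open>c i\<close> in each eigenvalue, summed over the
  eigenbasis of \<open>X\<close>; the trace inequality shows that it dominates \<open>Phi\<close> at every other matrix.\<close>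

lemma Phi_hat_le_tangent:
  fixes X :: "real^'n^'n"
  assumes X: "X \<in> psd_cone" and s: "1 \<le> s" "s \<le> CARD('n)" and t: "0 < t"
    and c: "\<And>i. i < s \<Longrightarrow> 0 < c i" and anti: "antimono_on {..<s} c"
  shows "Phi_hat s t X \<le> ereal ((\<Sum>i<s. ln (c i) + t / c i - 1) +
    (\<Sum>i<CARD('n). eigs_desc X ! i / c (min i (s - 1))))"
proof -
  let ?n = "CARD('n)"
  \<comment> \<open>Positions from \<open>s\<close> on reuse the last slope, so that
    \<open>d\<close> is increasing on all \<open>CARD('n)\<close> positions.\<close>
  define d where "d i = 1 / c (min i (s - 1))" for i
  have d_pos: "0 < d i" for i using c s by (simp add: d_def)
  have d_mono: "antimono_on {..<?n} (\<lambda>i. - d i)"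
    using anti s c by (auto simp: monotone_on_def d_def intro!: divide_left_mono)
  obtain q where q: "orthonormal q" and Xq: "X = spec (\<lambda>i. eigs_desc X ! i) q"
    using X spectral_decomposition unfolding psd_cone_def by blast
  define b where "b = (\<Sum>i<s. ln (c i) + t / c i - 1)"
  define g where "g Y = ereal (b + spec d q \<bullet> Y)" for Y
  have "concave_ext psd_cone g" unfolding g_def by (rule concave_ext_affine)
  moreover have "Phi s t Y \<le> g Y" if Y: "Y \<in> psd_cone" for Y
  proof -
    let ?y = "\<lambda>i. eigs_desc Y ! i"
    obtain r where r: "orthonormal r" and Yr: "Y = spec ?y r" and y: "antimono_on {..<?n} ?y"
      using Y spectral_decomposition unfolding psd_cone_def by blast
    have nonneg: "0 \<le> ?y i" if "i < ?n" for i using eigs_desc_nonneg[OF Y that] .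
    have neg: "spec (\<lambda>i. - d i) q = - spec d q" by (simp add: spec_def sum_negf)
    \<comment> \<open>The trace inequality bounds inner products from above; with \<open>- d\<close>
      it yields a lower bound that pairs the smallest slopes with the largest eigenvalues.\<close>
    have "- (spec d q \<bullet> Y) \<le> - (\<Sum>i<?n. d i * ?y i)"
      using von_neumann_trace[OF q r d_mono y] by (simp add: Yr[symmetric] neg sum_negf)
    moreover have "(\<Sum>i<s. d i * ?y i) \<le> (\<Sum>i<?n. d i * ?y i)"
      using s nonneg d_pos by (intro sum_mono2) (auto simp: less_imp_le)
    ultimately have le: "(\<Sum>i<s. d i * ?y i) \<le> spec d q \<bullet> Y" by linarith
    have "Phi s t Y \<le> (\<Sum>i<s. ereal (ln (c i) + t / c i - 1 + d i * ?y i))"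
      unfolding Phi_def
    proof (rule sum_mono)
      fix i assume i: "i \<in> {..<s}"
      then have pos: "0 < ?y i + t" "0 < c i" using nonneg[of i] t s c by auto
      have "ln ((?y i + t) / c i) \<le> (?y i + t) / c i - 1"
        using pos by (intro ln_le_minus_one) simp
      then have "ln (?y i + t) \<le> ln (c i) + t / c i - 1 + ?y i / c i"
        using pos by (simp add: ln_div) (simp add: add_divide_distrib)
      then show "elog (?y i + t) \<le> ereal (ln (c i) + t / c i - 1 + d i * ?y i)"
        using pos i s by (simp add: elog_def d_def min_absorb1)
    qed
    also have "\<dots> = ereal (b + (\<Sum>i<s. d i * ?y i))"
      by (simp add: b_def sum.distrib sum_subtractf)
    also have "\<dots> \<le> g Y" using le by (simp add: g_def)
    finally show ?thesis .
  qed
  ultimately have "Phi_hat s t X \<le> g X"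
    unfolding Phi_hat_def by (intro Inf_lower) blast
  moreover have "spec d q \<bullet> X = (\<Sum>i<?n. d i * eigs_desc X ! i)"
    by (subst Xq) (simp add: spec_def[of d] inner_sum_left inner_commute[of "outer _"] spec_inner_outer_self[OF q])
  ultimately show ?thesis by (simp add: g_def b_def d_def)
qed


text \<open>\<open>k\<close> is the water-filling index of the explicit formula for the envelope: the entries from
  \<open>k\<close> on are spread evenly over the positions \<open>k, \<dots>, s - 1\<close>.\<close>

lemma waterfilling:
  fixes \<nu> :: "nat \<Rightarrow> real"
  assumes anti: "antimono_on {..<n} \<nu>" and nonneg: "\<And>i. i < n \<Longrightarrow> 0 \<le> \<nu> i"
    and s: "1 \<le> s" "s \<le> n" and t: "0 < t"
  obtains c where "\<And>i. i < s \<Longrightarrow> 0 < c i" "antimono_on {..<s} c"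
    "\<And>m. m \<le> s \<Longrightarrow> (\<Sum>i<m. \<nu> i + t) \<le> (\<Sum>i<m. c i)"
    "(\<Sum>i<s. c i) = (\<Sum>i<n. \<nu> i) + real s * t"
    "(\<Sum>i<n. \<nu> i / c (min i (s - 1))) + (\<Sum>i<s. t / c i) = real s"
proof -
  define R where "R k = (\<Sum>i=k..<n. \<nu> i)" for k
  \<comment> \<open>\<open>P k\<close>: spreading the tail from \<open>k\<close> over the positions
    \<open>k, ..., s - 1\<close> gives a level of at least \<open>\<nu> k\<close>. It always holds
    at \<open>s - 1\<close>.\<close>
  define P where "P k \<longleftrightarrow> k < s \<and> real (s - k) * \<nu> k \<le> R k" for k
  have R_Suc: "R k = \<nu> k + R (Suc k)" if "k < n" for k
    using that by (simp add: R_def sum.atLeast_Suc_lessThan)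
  have R_nonneg: "0 \<le> R k" for k unfolding R_def using nonneg by (intro sum_nonneg) auto
  have "P (s - 1)" using s R_Suc[of "s - 1"] R_nonneg[of s] by (simp add: P_def)
  then have ex: "\<exists>k. P k" by blast
  define k where "k = (LEAST k. P k)"
  have Pk: "P k" unfolding k_def by (rule LeastI_ex[OF ex])
  then have ks: "k < s" and kn: "k < n" using s by (auto simp: P_def)
  define a where "a = R k / real (s - k)"
  have ka: "\<nu> k \<le> a" using Pk ks by (simp add: a_def P_def field_simps)
  \<comment> \<open>Minimality of \<open>k\<close> puts the level below all kept entries, which
    makes \<open>c\<close> decreasing.\<close>
  have prev: "a \<le> \<nu> i" if "i < k" for i
  proof -
    have "\<not> P (k - 1)" using not_less_Least[of "k - 1" P] that by (simp add: k_def[symmetric])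
    moreover have "k - 1 < s" using ks by simp
    ultimately have lt: "R (k - 1) < real (s - (k - 1)) * \<nu> (k - 1)" by (simp add: P_def not_le)
    have "real (s - (k - 1)) = real (s - k) + 1" using that ks by auto
    then have "R k < real (s - k) * \<nu> (k - 1)"
      using R_Suc[of "k - 1"] lt that kn by (simp add: distrib_right)
    then have "a \<le> \<nu> (k - 1)" using ks by (simp add: a_def field_simps)
    also have "\<dots> \<le> \<nu> i" using anti that kn by (auto simp: monotone_on_def)
    finally show ?thesis .
  qed
  have a_nonneg: "0 \<le> a" using R_nonneg by (simp add: a_def)
  have a_R: "real (s - k) * a = R k" using ks by (simp add: a_def)
  define c where "c i = (if i < k then \<nu> i else a) + t" for i
  have pos: "0 < c i" if "i < s" for i
    using that nonneg[of i] a_nonneg t s by (simp add: c_def)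
  have split: "(\<Sum>i<m. h i) = (\<Sum>i<k. h i) + (\<Sum>i=k..<m. h i)" if "k \<le> m" for m and h :: "nat \<Rightarrow> real"
    using that by (simp add: lessThan_atLeast0 sum.atLeastLessThan_concat)
  have "antimono_on {..<s} c"
    using anti s prev by (auto simp: monotone_on_def c_def)
  moreover have "(\<Sum>i<m. \<nu> i + t) \<le> (\<Sum>i<m. c i)" if "m \<le> s" for m
  proof (rule sum_mono)
    fix i assume i: "i \<in> {..<m}"
    show "\<nu> i + t \<le> c i"
    proof (cases "i < k")
      case False
      then have "\<nu> i \<le> \<nu> k" using i that s kn anti by (auto simp: monotone_on_def)
      then show ?thesis using ka False by (simp add: c_def)
    qed (simp add: c_def)
  qed
  moreover have "(\<Sum>i<s. c i) = (\<Sum>i<n. \<nu> i) + real s * t"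
  proof -
    have "(\<Sum>i<s. c i) = (\<Sum>i<s. if i < k then \<nu> i else a) + real s * t"
      by (simp add: c_def sum.distrib)
    also have "(\<Sum>i<s. if i < k then \<nu> i else a) = (\<Sum>i<k. \<nu> i) + R k"
      using ks a_R by (subst split) auto
    finally show ?thesis using split[of n \<nu>] kn by (simp add: R_def)
  qed
  \<comment> \<open>This makes the linear terms of the tangent bound cancel. Before \<open>k\<close>
    each position contributes \<open>(\<nu> i + t) / c i = 1\<close>; afterwards the total mass
    \<open>(s - k) (a + t)\<close> is divided by the constant \<open>a + t\<close>.\<close>
  moreover have "(\<Sum>i<n. \<nu> i / c (min i (s - 1))) + (\<Sum>i<s. t / c i) = real s"
  proof -
    have at: "0 < a + t" using a_nonneg t by simp
    \<comment> \<open>As \<open>k\<close> is at most \<open>s - 1\<close>, every capped index from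
      \<open>k\<close> on lands on the flat stretch of \<open>c\<close>.\<close>
    have cm: "c (min i (s - 1)) = (if i < k then c i else a + t)" for i
      using ks by (auto simp: c_def min_def)
    have "(\<Sum>i<n. \<nu> i / c (min i (s - 1))) = (\<Sum>i<k. \<nu> i / c i) + (\<Sum>i=k..<n. \<nu> i / (a + t))"
      unfolding cm using kn by (simp add: split[of n])
    also have "(\<Sum>i=k..<n. \<nu> i / (a + t)) = real (s - k) * a / (a + t)"
      by (simp add: a_R R_def sum_divide_distrib)
    finally have 1: "(\<Sum>i<n. \<nu> i / c (min i (s - 1))) = (\<Sum>i<k. \<nu> i / c i) + real (s - k) * a / (a + t)" .
    have 2: "(\<Sum>i<s. t / c i) = (\<Sum>i<k. t / c i) + real (s - k) * t / (a + t)"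
      using ks by (subst split) (auto simp: c_def)
    have "(\<Sum>i<k. \<nu> i / c i) + (\<Sum>i<k. t / c i) = (\<Sum>i<k. 1)"
      unfolding sum.distrib[symmetric]
    proof (rule sum.cong)
      fix i assume i: "i \<in> {..<k}"
      then have "0 < c i" "c i = \<nu> i + t" using pos[of i] ks by (auto simp: c_def)
      then show "\<nu> i / c i + t / c i = 1" by (simp add: add_divide_distrib[symmetric])
    qed simp
    moreover have "real (s - k) * a / (a + t) + real (s - k) * t / (a + t) = real (s - k)"
      using at by (simp add: add_divide_distrib[symmetric] distrib_left[symmetric])
    ultimately show ?thesis using 1 2 ks by (simp add: of_nat_diff)
  qed
  ultimately show thesis using that pos by blast
qed

section \<open>Lower bound for the envelope at \<open>t = 0\<close> by majorization\<close>

lemma spec_psd: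
  fixes q :: "nat \<Rightarrow> real^'n"
  assumes "\<And>i. i < CARD('n) \<Longrightarrow> 0 \<le> l i"
  shows "spec l q \<in> psd_cone"
proof -
  have "transpose (outer u) = outer u" for u :: "real^'n"
    by (simp add: outer_def transpose_def mult.commute)
  then have "transpose (spec l q) = spec l q"
    by (simp add: spec_def transpose_def vec_eq_iff)
  moreover have "v \<bullet> (spec l q *v v) = (\<Sum>i<CARD('n). l i * (q i \<bullet> v)\<^sup>2)" for v
    by (simp add: spec_mult_vec inner_sum_right power2_eq_square inner_commute mult_ac)
  ultimately show ?thesis
    using assms by (auto simp: psd_cone_def intro!: sum_nonneg)
qed

text \<open>A hyperplane separating \<open>spec \<mu> q\<close> from the hull would be a linear
  functional on spectra in the basis \<open>q\<close>. Arranging \<open>c\<close> in the order of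
  its coefficients gives a point of the hull on the wrong side.\<close>

lemma spec_majorized_in_hull:
  fixes q :: "nat \<Rightarrow> real^'n"
  assumes mu: "antimono_on {..<CARD('n)} \<mu>"
    and le: "\<And>m. m \<le> CARD('n) \<Longrightarrow> (\<Sum>i<m. \<mu> i) \<le> (\<Sum>i<m. c i)"
    and eq: "(\<Sum>i<CARD('n). \<mu> i) = (\<Sum>i<CARD('n). c i)"
  shows "spec \<mu> q \<in> convex hull ((\<lambda>p. spec c (q \<circ> p)) ` {p. p permutes {..<CARD('n)}})"
    (is "_ \<in> convex hull ?K")
proof (rule ccontr)
  let ?n = "CARD('n)"
  assume out: "spec \<mu> q \<notin> convex hull ?K"
  have "finite ?K" by (simp add: finite_permutations)
  then have "closed (convex hull ?K)" by (simp add: compact_imp_closed finite_imp_compact_convex_hull)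
  then obtain T b where T: "T \<bullet> spec \<mu> q < b" "\<And>Y. Y \<in> convex hull ?K \<Longrightarrow> b < T \<bullet> Y"
    using separating_hyperplane_closed_point[OF convex_convex_hull _ out] by blast
  \<comment> \<open>The sign turns the separation into a maximization, so that sorting
    \<open>f\<close> decreasingly pairs it with the leading entries of \<open>c\<close>.\<close>
  define f where "f i = - (T \<bullet> outer (q i))" for i
  obtain p where p: "p permutes {..<?n}" and anti: "antimono_on {..<?n} (f \<circ> p)"
    using sorting_permutation by blast
  have "(\<Sum>i<?n. \<mu> i * f i) = (\<Sum>i<?n. (f \<circ> p) i * (\<mu> \<circ> p) i)"
    using sum.permute[OF p, of "\<lambda>i. \<mu> i * f i"] by (simp add: o_def mult.commute)
  also have "\<dots> \<le> (\<Sum>i<?n. (f \<circ> p) i * c i)"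
  proof (rule abel_sum_mono[OF anti])
    fix m assume m: "m \<le> ?n"
    have sub: "p ` {..<m} \<subseteq> {..<?n}" using m permutes_in_image[OF p] by fastforce
    have inj: "inj_on p {..<m}" using permutes_inj[OF p] inj_on_subset by blast
    have ind: "(\<Sum>i<?n. h i * (if i \<in> p ` {..<m} then 1 else 0)) = (\<Sum>i<m. h (p i))"
      for h :: "nat \<Rightarrow> real"
      using sub by (simp add: if_distrib sum.If_cases Int_absorb1 sum.reindex[OF inj] cong: if_cong)
    \<comment> \<open>Any \<open>m\<close> entries of the decreasing \<open>\<mu>\<close> sum to at
      most its first \<open>m\<close>; the weights are the indicator of the chosen
      positions.\<close>
    have "(\<Sum>i<m. (\<mu> \<circ> p) i) \<le> (\<Sum>i<m. \<mu> i)"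
      using weighted_sum_le_top_sum[OF mu, of "\<lambda>i. if i \<in> p ` {..<m} then 1 else 0" m] m
        ind[of \<mu>] ind[of "\<lambda>_. 1"] by simp
    also have "\<dots> \<le> (\<Sum>i<m. c i)" using le[OF m] .
    finally show "(\<Sum>i<m. (\<mu> \<circ> p) i) \<le> (\<Sum>i<m. c i)" .
  next
    show "(\<Sum>i<?n. (\<mu> \<circ> p) i) = (\<Sum>i<?n. c i)"
      using sum.permute[OF p, of \<mu>] eq by (simp add: o_def)
  qed
  finally have "T \<bullet> spec c (q \<circ> p) \<le> T \<bullet> spec \<mu> q"
    by (simp add: spec_def inner_sum_right f_def sum_negf mult.commute)
  moreover have "spec c (q \<circ> p) \<in> convex hull ?K" using p by (intro hull_inc) auto
  ultimately show False using T by fastforce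
qed

text \<open>Superlevel sets of a concave majorant are convex, so a bound at all matrices with spectrum
  \<open>(c 0, \<dots>, c (s - 1), 0, \<dots>, 0)\<close> passes to their convex hull.\<close>

lemma Phi_hat_zero_ge:
  fixes X :: "real^'n^'n"
  assumes X: "X \<in> psd_cone" and s: "s \<le> CARD('n)"
    and c: "\<And>i. i < s \<Longrightarrow> 0 < c i" and anti: "antimono_on {..<s} c"
    and le: "\<And>m. m \<le> s \<Longrightarrow> (\<Sum>i<m. eigs_desc X ! i) \<le> (\<Sum>i<m. c i)"
    and eq: "(\<Sum>i<CARD('n). eigs_desc X ! i) = (\<Sum>i<s. c i)"
  shows "ereal (\<Sum>i<s. ln (c i)) \<le> Phi_hat s 0 X"
  unfolding Phi_hat_def
proof (rule Inf_greatest, safe)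
  let ?n = "CARD('n)"
  fix g :: "real^'n^'n \<Rightarrow> ereal"
  assume conc: "concave_ext psd_cone g" and ge: "\<forall>Y\<in>psd_cone. Phi s 0 Y \<le> g Y"
  define b where "b = (\<Sum>i<s. ln (c i))"
  define d where "d i = (if i < s then c i else 0)" for i
  have d_nonneg: "0 \<le> d i" for i using c by (simp add: d_def less_imp_le)
  have d_anti: "antimono_on {..<?n} d"
    using anti by (auto simp: monotone_on_def d_def intro: less_imp_le[OF c])
  have d_sum: "(\<Sum>i<m. d i) = (\<Sum>i<s. c i)" if "s \<le> m" for m
  proof -
    have "(\<Sum>i<m. d i) = (\<Sum>i<s. d i)" using that by (intro sum.mono_neutral_right) (auto simp: d_def)
    then show ?thesis by (simp add: d_def)
  qed
  obtain q where q: "orthonormal q" and Xq: "X = spec (\<lambda>i. eigs_desc X ! i) q"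
    and mu: "antimono_on {..<?n} (\<lambda>i. eigs_desc X ! i)"
    using X spectral_decomposition unfolding psd_cone_def by blast
  define K where "K = (\<lambda>p. spec d (q \<circ> p)) ` {p. p permutes {..<?n}}"
  have "spec (\<lambda>i. eigs_desc X ! i) q \<in> convex hull K"
    unfolding K_def
  proof (rule spec_majorized_in_hull[OF mu])
    fix m assume m: "m \<le> ?n"
    show "(\<Sum>i<m. eigs_desc X ! i) \<le> (\<Sum>i<m. d i)"
    proof (cases "m \<le> s")
      \<comment> \<open>Past \<open>s\<close> the sums of \<open>d\<close> have reached the full
        trace, and the eigenvalues of \<open>X\<close> are nonnegative.\<close>
      case False
      have "(\<Sum>i<m. eigs_desc X ! i) \<le> (\<Sum>i<?n. eigs_desc X ! i)"
        using m eigs_desc_nonneg[OF X] by (intro sum_mono2) auto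
      then show ?thesis using False d_sum[of m] eq by simp
    qed (use le[of m] in \<open>simp add: d_def\<close>)
  qed (simp add: eq d_sum[OF s])
  moreover have "convex hull K \<subseteq> {Y \<in> psd_cone. ereal b \<le> g Y}"
  proof (rule hull_minimal)
    show "K \<subseteq> {Y \<in> psd_cone. ereal b \<le> g Y}"
    proof
      fix Y assume "Y \<in> K"
      then obtain p where p: "p permutes {..<?n}" and Y: "Y = spec d (q \<circ> p)" by (auto simp: K_def)
      have psd: "Y \<in> psd_cone" unfolding Y by (rule spec_psd) (rule d_nonneg)
      have "Phi s 0 Y = (\<Sum>i<s. ereal (ln (c i)))"
        unfolding Phi_def Y eigs_desc_spec[OF orthonormal_permute[OF q p] d_anti]
        using s c by (intro sum.cong) (auto simp: elog_def d_def)
      then have "ereal b \<le> g Y" using ge psd by (auto simp: b_def)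
      then show "Y \<in> {Y \<in> psd_cone. ereal b \<le> g Y}" using psd by simp
    qed
    show "convex {Y \<in> psd_cone. ereal b \<le> g Y}"
    proof (rule convexI, safe)
      fix Y Z :: "real^'n^'n" and u v :: real
      assume Y: "Y \<in> psd_cone" "ereal b \<le> g Y" and Z: "Z \<in> psd_cone" "ereal b \<le> g Z"
        and uv: "0 \<le> u" "0 \<le> v" "u + v = 1"
      show "u *\<^sub>R Y + v *\<^sub>R Z \<in> psd_cone"
        using Y(1) Z(1) uv
        by (auto simp: psd_cone_def transpose_def vec_eq_iff matrix_vector_mult_add_rdistrib
            scaleR_matrix_vector_assoc[symmetric] inner_add_right)
      have v: "v = 1 - u" using uv by simp
      have "ereal (u * b + (1 - u) * b) \<le> g (u *\<^sub>R Y + (1 - u) *\<^sub>R Z)"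
        using conc Y Z uv unfolding concave_ext_def by auto
      then show "ereal b \<le> g (u *\<^sub>R Y + v *\<^sub>R Z)" by (simp add: v algebra_simps)
    qed
  qed
  ultimately show "ereal (\<Sum>i<s. ln (c i)) \<le> g X" using Xq by (auto simp: b_def)
qed

section \<open>Comparing the matrices for \<open>t\<close> and for \<open>0\<close> at a fixed
  \<open>x\<close>\<close>

lemma gram_psd:
  fixes B :: "real^'n^'n"
  shows "B ** transpose B \<in> psd_cone"
proof -
  have "v \<bullet> ((B ** transpose B) *v v) = (transpose B *v v) \<bullet> (transpose B *v v)" for v
    by (metis dot_lmul_matrix matrix_vector_mul_assoc transpose_matrix_vector)
  then show ?thesis by (simp add: psd_cone_def matrix_transpose_mul)
qed

lemma eigs_desc_gram_commute:
  fixes B :: "real^'n^'n"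
  shows "eigs_desc (B ** transpose B) = eigs_desc (transpose B ** B)"
  by (simp add: eigs_desc_def charpoly_gram_commute)

text \<open>The factor is \<open>A\<close> with columns scaled by the roots of \<open>x\<close>. Its
  other Gram product depends on \<open>A\<close> only through \<open>transpose A ** A\<close>, which
  links the two factorizations.\<close>

lemma M_of_gram:
  fixes A :: "real^'n^'n"
  assumes "\<And>i. 0 \<le> x$i"
  shows "M_of A x = (\<chi> i j. A$i$j * sqrt (x$j)) ** transpose (\<chi> i j. A$i$j * sqrt (x$j))"
proof -
  have *: "a * sqrt y * (b * sqrt y) = y * (a * b)" if "0 \<le> y" for a b y :: real
    using that by (metis mult.assoc mult.commute real_sqrt_mult_self abs_of_nonneg)
  then show ?thesis
    using assms
    by (simp add: M_of_def outer_def column_def matrix_matrix_mult_def transpose_def vec_eq_iff *)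
qed

text \<open>Ky Fan: adding \<open>t D\<close> with \<open>0 \<le> D \<le> I\<close> raises the sum of the \<open>m\<close> largest eigenvalues by
  at most \<open>m t\<close>.\<close>

lemma eigs_desc_add_diagonal:
  fixes N :: "real^'n^'n"
  assumes N: "transpose N = N" and x: "\<And>i. 0 \<le> x$i \<and> x$i \<le> 1" and t: "0 \<le> t"
  defines "P \<equiv> N + t *\<^sub>R (\<chi> i j. if i = j then x$i else 0)"
  shows "m \<le> CARD('n) \<Longrightarrow> (\<Sum>i<m. eigs_desc P ! i) \<le> (\<Sum>i<m. eigs_desc N ! i + t)"
    and "(\<Sum>i<CARD('n). eigs_desc P ! i) = (\<Sum>i<CARD('n). eigs_desc N ! i) + t * (\<Sum>i\<in>UNIV. x$i)"
proof -
  let ?n = "CARD('n)"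
  let ?\<nu> = "\<lambda>i. eigs_desc N ! i"
  have P: "transpose P = P" using N by (auto simp: P_def transpose_def vec_eq_iff)
  obtain q where q: "orthonormal q" and Nq: "N = spec ?\<nu> q" and nu: "antimono_on {..<?n} ?\<nu>"
    using N by (rule spectral_decomposition)
  obtain r where r: "orthonormal r" and Pr: "P = spec (\<lambda>i. eigs_desc P ! i) r"
    using P by (rule spectral_decomposition)
  have diag: "(\<chi> i j. if i = j then x$i else 0) \<bullet> outer w = (\<Sum>i\<in>UNIV. x$i * (w$i)\<^sup>2)" for w :: "real^'n"
    by (simp add: inner_vec_def outer_def if_distrib if_distribR power2_eq_square cong: if_cong)
  \<comment> \<open>Each eigenvalue of \<open>P\<close> is its quadratic form at the unit
    eigenvector \<open>r j\<close>, which splits into the part of \<open>N\<close> and the diagonal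
    part.\<close>
  have eig: "eigs_desc P ! j = (\<Sum>i<?n. ?\<nu> i * (q i \<bullet> r j)\<^sup>2) + t * (\<Sum>i\<in>UNIV. x$i * (r j$i)\<^sup>2)"
    if "j < ?n" for j
  proof -
    have "eigs_desc P ! j = P \<bullet> outer (r j)"
      using r that by (subst (2) Pr) (simp add: spec_inner_outer_self)
    also have "\<dots> = N \<bullet> outer (r j) + t * (\<Sum>i\<in>UNIV. x$i * (r j$i)\<^sup>2)"
      by (simp add: P_def inner_add_left diag)
    also have "N \<bullet> outer (r j) = (\<Sum>i<?n. ?\<nu> i * (q i \<bullet> r j)\<^sup>2)"
      by (subst Nq) (rule spec_inner_outer)
    finally show ?thesis .
  qed
  have sum_eq: "(\<Sum>j<m. eigs_desc P ! j) =
      (\<Sum>i<?n. ?\<nu> i * (\<Sum>j<m. (q i \<bullet> r j)\<^sup>2)) + t * (\<Sum>j<m. \<Sum>i\<in>UNIV. x$i * (r j$i)\<^sup>2)"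
    if "m \<le> ?n" for m
  proof -
    have "(\<Sum>j<m. eigs_desc P ! j) =
        (\<Sum>j<m. (\<Sum>i<?n. ?\<nu> i * (q i \<bullet> r j)\<^sup>2) + t * (\<Sum>i\<in>UNIV. x$i * (r j$i)\<^sup>2))"
      using that by (intro sum.cong) (auto simp: eig)
    also have "\<dots> = (\<Sum>j<m. \<Sum>i<?n. ?\<nu> i * (q i \<bullet> r j)\<^sup>2) + t * (\<Sum>j<m. \<Sum>i\<in>UNIV. x$i * (r j$i)\<^sup>2)"
      by (simp add: sum.distrib sum_distrib_left)
    also have "(\<Sum>j<m. \<Sum>i<?n. ?\<nu> i * (q i \<bullet> r j)\<^sup>2) = (\<Sum>i<?n. ?\<nu> i * (\<Sum>j<m. (q i \<bullet> r j)\<^sup>2))"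
      by (subst sum.swap) (simp add: sum_distrib_left)
    finally show ?thesis .
  qed
  show "(\<Sum>i<m. eigs_desc P ! i) \<le> (\<Sum>i<m. ?\<nu> i + t)" if m: "m \<le> ?n"
  proof -
    have "(\<Sum>i<?n. ?\<nu> i * (\<Sum>j<m. (q i \<bullet> r j)\<^sup>2)) \<le> (\<Sum>i<m. ?\<nu> i)"
      using orthonormal_overlap[OF q r m] m
      by (intro weighted_sum_le_top_sum[OF nu]) (auto intro: sum_nonneg)
    moreover have "(\<Sum>j<m. \<Sum>i\<in>UNIV. x$i * (r j$i)\<^sup>2) \<le> (\<Sum>j<m. 1)"
    proof (rule sum_mono)
      fix j assume "j \<in> {..<m}"
      then have "r j \<bullet> r j = 1" using r m by (simp add: orthonormal_def)
      moreover have "(\<Sum>i\<in>UNIV. x$i * (r j$i)\<^sup>2) \<le> (\<Sum>i\<in>UNIV. 1 * (r j$i)\<^sup>2)"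
        using x by (intro sum_mono mult_right_mono) auto
      ultimately show "(\<Sum>i\<in>UNIV. x$i * (r j$i)\<^sup>2) \<le> 1"
        by (simp add: inner_vec_def power2_eq_square)
    qed
    then have "t * (\<Sum>j<m. \<Sum>i\<in>UNIV. x$i * (r j$i)\<^sup>2) \<le> t * real m"
      using t by (intro mult_left_mono) auto
    ultimately show ?thesis using sum_eq[OF m] by (simp add: sum.distrib mult.commute)
  qed
  \<comment> \<open>The trace of the diagonal part in the basis \<open>r\<close>, by Parseval for
    the coordinate vectors.\<close>
  have "(\<Sum>j<?n. \<Sum>i\<in>UNIV. x$i * (r j$i)\<^sup>2) = (\<Sum>i\<in>UNIV. x$i * (\<Sum>j<?n. (r j \<bullet> axis i 1)\<^sup>2))"
    by (subst sum.swap) (simp add: sum_distrib_left inner_axis)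
  also have "\<dots> = (\<Sum>i\<in>UNIV. x$i)"
    by (subst parseval[OF r]) (simp add: inner_axis_axis)
  finally show "(\<Sum>i<?n. eigs_desc P ! i) = (\<Sum>i<?n. ?\<nu> i) + t * (\<Sum>i\<in>UNIV. x$i)"
    using sum_eq[OF order_refl] orthonormal_overlap(2)[OF q r order_refl] by simp
qed

text \<open>One vector \<open>c\<close>, built from the spectrum of \<open>M_of At x\<close>, serves
  both sides: its log sum bounds the envelope for \<open>t\<close> from above and the envelope for
  \<open>0\<close> from below.\<close>

lemma Phi_hat_M_of_mono:
  fixes C A0 At :: "real^'n^'n"
  assumes s: "1 \<le> s" "s \<le> CARD('n)" and t: "0 < t"
    and A0: "transpose A0 ** A0 = C" and At: "transpose At ** At = C - t *\<^sub>R mat 1"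
    and x: "\<And>i. 0 \<le> x$i \<and> x$i \<le> 1" and sum_x: "(\<Sum>i\<in>UNIV. x$i) = real s"
  shows "Phi_hat s t (M_of At x) \<le> Phi_hat s 0 (M_of A0 x)"
proof -
  let ?n = "CARD('n)"
  define B where "B = (\<chi> i j. A0$i$j * sqrt (x$j))"
  define E where "E = (\<chi> i j. At$i$j * sqrt (x$j))"
  have MB: "M_of A0 x = B ** transpose B" and ME: "M_of At x = E ** transpose E"
    using x by (simp_all add: M_of_gram B_def E_def)
  let ?\<nu> = "\<lambda>i. eigs_desc (M_of At x) ! i"
  let ?\<mu> = "\<lambda>i. eigs_desc (M_of A0 x) ! i"
  have scaled: "(transpose (\<chi> i j. A$i$j * sqrt (x$j)) ** (\<chi> i j. A$i$j * sqrt (x$j))) $ i $ j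
      = sqrt (x$i) * sqrt (x$j) * (transpose A ** A) $ i $ j" for A :: "real^'n^'n" and i j
    by (simp add: matrix_matrix_mult_def transpose_def sum_distrib_left mult_ac)
  have BE: "transpose B ** B = transpose E ** E + t *\<^sub>R (\<chi> i j. if i = j then x$i else 0)"
    using x by (auto simp: vec_eq_iff B_def E_def scaled A0 At mat_def right_diff_distrib)
  have "transpose (transpose E ** E) = transpose E ** E" by (simp add: matrix_transpose_mul)
  \<comment> \<open>The comparison concerns the products \<open>transpose E ** E\<close> and
    \<open>transpose B ** B\<close>; folding carries it to \<open>M_of At x\<close> and
    \<open>M_of A0 x\<close>, which have the same spectra.\<close>
  note cmp = eigs_desc_add_diagonal[OF this x less_imp_le[OF t], folded BE eigs_desc_gram_commute MB ME]
  have psdE: "M_of At x \<in> psd_cone" and psdB: "M_of A0 x \<in> psd_cone"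
    unfolding MB ME by (rule gram_psd)+
  have anti: "antimono_on {..<?n} ?\<nu>"
    using psdE spectral_decomposition unfolding psd_cone_def by blast
  obtain c where pos: "\<And>i. i < s \<Longrightarrow> 0 < c i" and c_anti: "antimono_on {..<s} c"
    and part: "\<And>m. m \<le> s \<Longrightarrow> (\<Sum>i<m. ?\<nu> i + t) \<le> (\<Sum>i<m. c i)"
    and total: "(\<Sum>i<s. c i) = (\<Sum>i<?n. ?\<nu> i) + real s * t"
    and tangent: "(\<Sum>i<?n. ?\<nu> i / c (min i (s - 1))) + (\<Sum>i<s. t / c i) = real s"
    using waterfilling[OF anti eigs_desc_nonneg[OF psdE] s t] by blast
  have "Phi_hat s t (M_of At x) \<le> ereal ((\<Sum>i<s. ln (c i) + t / c i - 1) +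
      (\<Sum>i<?n. ?\<nu> i / c (min i (s - 1))))"
    by (rule Phi_hat_le_tangent[OF psdE s t pos c_anti])
  also have "\<dots> = ereal (\<Sum>i<s. ln (c i))"
    using tangent by (simp add: sum.distrib sum_subtractf)
  also have "\<dots> \<le> Phi_hat s 0 (M_of A0 x)"
  proof (rule Phi_hat_zero_ge[OF psdB s(2) pos c_anti])
    show "(\<Sum>i<m. ?\<mu> i) \<le> (\<Sum>i<m. c i)" if "m \<le> s" for m
      using cmp(1)[of m] part[OF that] that s by simp
    show "(\<Sum>i<?n. ?\<mu> i) = (\<Sum>i<s. c i)"
      using cmp(2) total sum_x by (simp add: mult.commute)
  qed
  finally show ?thesis .
qed

theorem theorem2:
  fixes C A0 At :: "((real, 'n::{finite,wellorder}) vec, 'n::{finite,wellorder}) vec"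
    and s :: nat and t :: real
  assumes "1 \<le> s" and "s \<le> CARD('n)"
    and "sym_pos_def C"
    and "0 < t" and "t \<le> lambda_min C"
    and "cholesky_factor A0 C"
    and "cholesky_factor At (C - t *\<^sub>R mat 1)"
  shows "zhat s t At \<le> zhat s 0 A0"
  unfolding zhat_def
\<comment> \<open>Both suprema range over the same feasible \<open>x\<close>, so a pointwise
  comparison suffices.\<close>
proof (rule Sup_mono, safe)
  fix x :: "(real, 'n) vec"
  assume x: "\<forall>i. 0 \<le> x$i \<and> x$i \<le> 1" "(\<Sum>i\<in>UNIV. x$i) = real s"
  have "Phi_hat s t (M_of At x) \<le> Phi_hat s 0 (M_of A0 x)"
    using assms x by (intro Phi_hat_M_of_mono[where C = C]) (auto simp: cholesky_factor_def)
  then show "\<exists>b\<in>{Phi_hat s 0 (M_of A0 x) |x. (\<forall>i. 0 \<le> x$i \<and> x$i \<le> 1) \<and>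
      (\<Sum>i\<in>UNIV. x$i) = real s}. Phi_hat s t (M_of At x) \<le> b"
    using x by blast
qed

end
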